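(* Let $C_1, C_2, C_3$ be three distinct points on a line with $C_2$ between $C_1$ and $C_3$. Consider the parbelos they determine, with outer (upper) parabola $G_2$ and tangent rectangle $C_2T_1T_2T_3$. Then the diagonal of the tangent rectangle opposite the cusp $C_2$, i.e. $T_1T_3$, is tangent to the upper parabola $G_2$. Moreover, the point of contact of $T_1T_3$ with $G_2$ lies on the bisector of the angle $\angle T_1C_2T_3$ at the cusp $C_2$.
   Context: All objects lie in the Euclidean plane. The latus rectum of a parabola is the chord through its focus parallel to its directrix. Given distinct points $C_1,C_2,C_3$ on a line with $C_2$ between $C_1$ and $C_3$, let $G_1, G_2, G_3$ be the parabolas that open in the same direction (perpendicular to the line $C_1C_3$, on the same side) and whose latera recta are the segments $C_1C_2$, $C_1C_3$, $C_2C_3$, respectively. The parbelos is the region bounded by the three latus rectum arcs, i.e. the arcs of $G_1,G_2,G_3$ cut off by their latera recta. $G_2$ is called the outer or upper parabola, and $C_1,C_2,C_3$ are the cusps. The tangent line of a parabola at either endpoint of its latus rectum makes an angle $\pi/4$ with the latus rectum, so $G_1$ and $G_2$ have a common tangent line $t_1$ at $C_1$, and $G_2$ and $G_3$ have a common tangent line $t_3$ at $C_3$. Let $m_1$ be the tangent line to $G_1$ at $C_2$ and $m_3$ the tangent line to $G_3$ at $C_2$. The four lines $t_1,t_3,m_1,m_3$ bound a rectangle, called the tangent rectangle, with vertices $C_2$, $T_1 = t_1\cap m_1$, $T_2 = t_1\cap t_3$, $T_3 = t_3\cap m_3$. The bisector at the cusp $C_2$ is the internal bisector of the angle $\angle T_1C_2T_3$.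 *)

theory Defs
  imports "HOL-Analysis.Analysis"
begin

type_synonym point = "real ^ 2"

definition is_line :: "point set \<Rightarrow> bool" where
  "is_line L \<longleftrightarrow> affine L \<and> aff_dim L = 1"

definition parabola :: "point \<Rightarrow> point set \<Rightarrow> point set" where
  "parabola F d = {P. dist P F = infdist P d}"

definition is_latus_rectum :: "point \<Rightarrow> point set \<Rightarrow> point set \<Rightarrow> bool" where
  "is_latus_rectum F d S \<longleftrightarrow>
     (\<exists>A B. A \<noteq> B \<and> A \<in> parabola F d \<and> B \<in> parabola F d \<and>
            S = closed_segment A B \<and> F \<in> S \<and>
            affine_parallel (affine hull {A, B}) d)"

text \<open>The parabola with focus \<open>F\<close> and directrix \<open>d\<close> opens perpendicularly to \<open>d\<close>, towards the
  side of \<open>d\<close> that contains \<open>F\<close>.\<close>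

definition opens_towards :: "point \<Rightarrow> point set \<Rightarrow> point \<Rightarrow> bool" where
  "opens_towards F d u \<longleftrightarrow>
     (\<forall>x\<in>d. \<forall>y\<in>d. orthogonal u (x - y)) \<and> (\<exists>q\<in>d. \<exists>t>0. F = q + t *\<^sub>R u)"

definition parabola_on_latus_rectum :: "point \<Rightarrow> point \<Rightarrow> point \<Rightarrow> point set \<Rightarrow> bool" where
  "parabola_on_latus_rectum u A B G \<longleftrightarrow>
     (\<exists>F d. is_line d \<and> F \<notin> d \<and> G = parabola F d \<and>
            is_latus_rectum F d (closed_segment A B) \<and> opens_towards F d u)"

text \<open>Tangency as the limiting position of secants: the quotient below is the sine of the angle
  between the line \<open>L\<close> and the secant \<open>PQ\<close>, where \<open>Q\<close> tends to \<open>P\<close> along the curve \<open>S\<close>. The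
  limit-point condition excludes isolated points, where the limit would hold vacuously.\<close>

definition tangent_line_at :: "point set \<Rightarrow> point \<Rightarrow> point set \<Rightarrow> bool" where
  "tangent_line_at S P L \<longleftrightarrow>
     is_line L \<and> P \<in> S \<and> P \<in> L \<and> P islimpt S \<and>
     ((\<lambda>Q. infdist Q L / dist Q P) \<longlongrightarrow> 0) (at P within S)"

definition angle_at :: "point \<Rightarrow> point \<Rightarrow> point \<Rightarrow> real" where
  "angle_at A V B = arccos (((A - V) \<bullet> (B - V)) / (norm (A - V) * norm (B - V)))"

text \<open>The internal bisector is a ray. Its origin \<open>V\<close> is added separately because
  \<open>angle_at\<close> is meaningful only when both outer points differ from the vertex.\<close>

definition internal_bisector :: "point \<Rightarrow> point \<Rightarrow> point \<Rightarrow> point set" where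
  "internal_bisector A V B =
     insert V {X. X \<noteq> V \<and> angle_at A V X = angle_at A V B / 2 \<and>
                         angle_at X V B = angle_at A V B / 2}"

end

theory Submission
  imports Defs
begin

text \<open>
  Let \<open>e\<close> be the unit vector along the line of the cusps and \<open>n\<close> the unit vector in the direction
  in which the parabolas open. A parabola with latus rectum of length \<open>2 h\<close> and focus \<open>F\<close> has, in
  coordinates relative to \<open>F\<close>, the equation \<open>x\<^sup>2 = 2 h y + h\<^sup>2\<close>
  (\<open>parabola_on_latus_rectum_eq_upward_parabola\<close>). Such a parabola has exactly one tangent line at
  each point, and its slope is \<open>x / h\<close> (\<open>tangent_upward_parabola_iff\<close>). Since the slope
  determines \<open>x\<close>, a line is tangent to the parabola at one point at most
  (\<open>tangent_point_unique\<close>).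

  Put the origin at \<open>C2\<close> and write \<open>C1 = (- 2 a, 0)\<close>, \<open>C3 = (2 b, 0)\<close>. The sides of the tangent
  rectangle have slopes \<open>1\<close> and \<open>- 1\<close>, so \<open>T1 = (- a, - a)\<close> and \<open>T3 = (b, - b)\<close>. The diagonal
  \<open>T1 T3\<close> has slope \<open>(a - b) / (a + b)\<close>. The outer parabola has focus \<open>(b - a, 0)\<close> and \<open>h = a + b\<close>,
  so its tangent has this slope where the abscissa relative to the focus is \<open>a - b\<close>, that is, at
  the point \<open>P = (0, - 2 a b / (a + b))\<close> straight below \<open>C2\<close>. The identity
  \<open>P = (b T1 + a T3) / (a + b)\<close> places \<open>P\<close> on the diagonal, so the diagonal is the tangent at \<open>P\<close>
  and at no other point.
  The rays from \<open>C2\<close> to \<open>T1\<close> and \<open>T3\<close> both make the angle \<open>\<pi> / 4\<close> with the downward vertical, so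
  \<open>P\<close> is on the bisector.
\<close>

section \<open>Lines in the plane\<close>

lemma is_line_affine_hull_2:
  assumes "A \<noteq> B"
  shows "is_line (affine hull {A, B})"
  using assms by (simp add: is_line_def aff_dim_affine_hull aff_dim_2)

lemma is_line_eq_affine_hull_2:
  assumes L: "is_line L" and P: "P \<in> L"
  obtains Q where "Q \<noteq> P" "L = affine hull {P, Q}"
proof -
  have "L \<noteq> {P}"
    using L by (auto simp: is_line_def)
  then obtain Q where Q: "Q \<in> L" "Q \<noteq> P"
    using P by blast
  have "affine hull {P, Q} \<subseteq> L"
    using L P Q by (intro hull_minimal) (auto simp: is_line_def)
  then have "affine hull {P, Q} = L"
    using L Q(2) by (intro affine_dim_equal) (auto simp: is_line_def aff_dim_2)
  with Q that show thesis by blast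
qed

text \<open>By Cauchy--Schwarz, the component of \<open>X - P\<close> along a unit normal of the line bounds the
  distance from \<open>X\<close> to the line from below.\<close>

lemma abs_inner_le_infdist:
  fixes P X w :: point
  assumes "norm w = 1" and "P \<in> L" and orth: "\<And>Y. Y \<in> L \<Longrightarrow> (Y - P) \<bullet> w = 0"
  shows "\<bar>(X - P) \<bullet> w\<bar> \<le> infdist X L"
proof -
  have "\<bar>(X - P) \<bullet> w\<bar> \<le> dist X Y" if "Y \<in> L" for Y
  proof -
    have "(X - P) \<bullet> w = (X - Y) \<bullet> w"
      using orth[OF that] by (simp add: inner_diff_left)
    then show ?thesis
      using Cauchy_Schwarz_ineq2[of "X - Y" w] assms(1) by (simp add: dist_norm)
  qed
  moreover have "L \<noteq> {}" using assms(2) by blast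
  ultimately show ?thesis
    by (auto simp: infdist_notempty intro!: cINF_greatest)
qed

section \<open>Coordinates in an orthonormal frame\<close>

locale orthonormal_frame =
  fixes e n :: point
  assumes norm_e [simp]: "norm e = 1" and norm_n [simp]: "norm n = 1"
    and orth [simp]: "e \<bullet> n = 0"
begin

lemma frame_inner [simp]: "n \<bullet> e = 0" "e \<bullet> e = 1" "n \<bullet> n = 1"
  using orth by (simp_all add: inner_commute dot_square_norm)

lemma frame_expansion: "v = (v \<bullet> e) *\<^sub>R e + (v \<bullet> n) *\<^sub>R n"
proof -
  have "e \<noteq> n" using frame_inner(2) orth by fastforce
  have "pairwise orthogonal {e, n}"
    by (auto simp: pairwise_def orthogonal_def)
  moreover have "e \<noteq> 0" "n \<noteq> 0"
    using norm_e norm_n by (metis norm_zero zero_neq_one)+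
  then have "0 \<notin> {e, n}" by simp
  ultimately have "independent {e, n}"
    by (rule pairwise_orthogonal_independent)
  then have "UNIV \<subseteq> span {e, n}"
    by (intro card_ge_dim_independent) (use \<open>e \<noteq> n\<close> in \<open>auto simp: dim_UNIV\<close>)
  then have "v \<in> span {e, n}" by blast
  then obtain x y where "v = x *\<^sub>R e + y *\<^sub>R n"
    unfolding span_insert span_singleton
    by (auto simp: algebra_simps eq_diff_eq)
  then show ?thesis by (simp add: inner_add_left)
qed

lemma frame_eqI:
  assumes "v \<bullet> e = w \<bullet> e" "v \<bullet> n = w \<bullet> n"
  shows "v = w"
proof -
  have "v = (v \<bullet> e) *\<^sub>R e + (v \<bullet> n) *\<^sub>R n" by (rule frame_expansion)
  also have "\<dots> = (w \<bullet> e) *\<^sub>R e + (w \<bullet> n) *\<^sub>R n" by (simp only: assms)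
  also have "\<dots> = w" by (rule frame_expansion[symmetric])
  finally show ?thesis .
qed

lemma norm_frame: "(norm v)\<^sup>2 = (v \<bullet> e)\<^sup>2 + (v \<bullet> n)\<^sup>2"
proof -
  have "v \<bullet> v = (v \<bullet> e) * (v \<bullet> e) + (v \<bullet> n) * (v \<bullet> n)"
    using arg_cong[OF frame_expansion[of v], of "\<lambda>x. v \<bullet> x"]
    by (simp add: inner_add_right)
  then show ?thesis
    unfolding power2_norm_eq_inner by (simp add: power2_eq_square)
qed

definition sloped_line :: "point \<Rightarrow> real \<Rightarrow> point set" where
  "sloped_line P m = {X. (X - P) \<bullet> n = m * ((X - P) \<bullet> e)}"

lemma affine_hull_eq_sloped_line:
  assumes "A \<noteq> B" and slope: "(B - A) \<bullet> n = m * ((B - A) \<bullet> e)"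
  shows "affine hull {A, B} = sloped_line A m"
proof -
  let ?x = "(B - A) \<bullet> e"
  have x0: "?x \<noteq> 0"
    using assms frame_eqI[of "B - A" 0] by auto
  have "X \<in> affine hull {A, B} \<longleftrightarrow> X \<in> sloped_line A m" for X
  proof
    assume "X \<in> affine hull {A, B}"
    then obtain s t where X: "X = s *\<^sub>R A + t *\<^sub>R B" and "s + t = 1"
      by (auto simp: affine_hull_2)
    then have "s = 1 - t" by simp
    with X have "X - A = t *\<^sub>R (B - A)" by (simp add: algebra_simps)
    then show "X \<in> sloped_line A m"
      using slope by (simp add: sloped_line_def)
  next
    assume X: "X \<in> sloped_line A m"
    let ?t = "((X - A) \<bullet> e) / ?x"
    have "X - A = ?t *\<^sub>R (B - A)"
      by (rule frame_eqI) (use X slope x0 in \<open>simp_all add: sloped_line_def\<close>)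
    then have "X = (1 - ?t) *\<^sub>R A + ?t *\<^sub>R B"
      by (simp add: algebra_simps)
    moreover have "1 - ?t + ?t = 1" by simp
    ultimately show "X \<in> affine hull {A, B}"
      unfolding affine_hull_2 by blast
  qed
  then show ?thesis by blast
qed

lemma is_line_sloped_line: "is_line (sloped_line P m)"
proof -
  let ?v = "e + m *\<^sub>R n"
  have "?v \<bullet> e = 1" by (simp add: inner_add_left)
  then have "P \<noteq> P + ?v" by auto
  moreover have "affine hull {P, P + ?v} = sloped_line P m"
    by (rule affine_hull_eq_sloped_line) (use calculation in \<open>simp_all add: inner_add_left\<close>)
  ultimately show ?thesis using is_line_affine_hull_2 by metis
qed

lemma sloped_line_change_point:
  assumes "Q \<in> sloped_line P m"
  shows "sloped_line P m = sloped_line Q m"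
proof -
  have "(X - Q) \<bullet> v = (X - P) \<bullet> v - (Q - P) \<bullet> v" for X v :: point
    by (simp add: inner_diff_left)
  then show ?thesis
    using assms by (auto simp: sloped_line_def right_diff_distrib)
qed

lemma sloped_line_eqD:
  assumes eq: "sloped_line P m = sloped_line Q m'"
  shows "m = m'"
proof -
  have "P + (e + m *\<^sub>R n) \<in> sloped_line P m" "P \<in> sloped_line P m"
    by (simp_all add: sloped_line_def inner_add_left)
  then show ?thesis
    unfolding eq by (simp add: sloped_line_def inner_add_left inner_diff_left algebra_simps)
qed

lemma infdist_horizontal_line: "infdist X (sloped_line q 0) = \<bar>(X - q) \<bullet> n\<bar>"
proof (rule antisym)
  let ?Y = "X - ((X - q) \<bullet> n) *\<^sub>R n"
  have "?Y \<in> sloped_line q 0"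
    by (simp add: sloped_line_def inner_diff_left)
  then have "infdist X (sloped_line q 0) \<le> dist X ?Y" by (rule infdist_le)
  then show "infdist X (sloped_line q 0) \<le> \<bar>(X - q) \<bullet> n\<bar>"
    by (simp add: dist_norm)
  show "\<bar>(X - q) \<bullet> n\<bar> \<le> infdist X (sloped_line q 0)"
    by (rule abs_inner_le_infdist) (auto simp: sloped_line_def)
qed

section \<open>The equation of a parabola with a given latus rectum\<close>

definition upward_parabola :: "point \<Rightarrow> real \<Rightarrow> point set" where
  "upward_parabola F h = {X. ((X - F) \<bullet> e)\<^sup>2 = 2 * h * ((X - F) \<bullet> n) + h\<^sup>2}"

text \<open>The endpoints of the latus rectum have the same distance from the directrix, hence from the
  focus. So the focus is their midpoint, and its distance from the directrix is half the length
  of the latus rectum. The condition that the parabola opens towards \<open>n\<close> decides on which side the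
  directrix lies.\<close>

lemma parabola_on_latus_rectum_eq_upward_parabola:
  assumes c: "c > 0" and h: "h > 0" and B: "B = A + (2 * h) *\<^sub>R e"
    and G: "parabola_on_latus_rectum (c *\<^sub>R n) A B G"
  shows "G = upward_parabola (A + h *\<^sub>R e) h"
proof -
  from G obtain F d where d: "is_line d" and G_eq: "G = parabola F d"
    and lr: "is_latus_rectum F d (closed_segment A B)"
    and opens: "opens_towards F d (c *\<^sub>R n)"
    unfolding parabola_on_latus_rectum_def by blast
  from lr obtain A' B' where A'B': "A' \<in> G" "B' \<in> G" "closed_segment A B = closed_segment A' B'"
    and F: "F \<in> closed_segment A B"
    unfolding is_latus_rectum_def G_eq by blast
  then have "{A, B} = {A', B'}" by (simp add: closed_segment_eq)
  then have AB: "A \<in> G" "B \<in> G" using A'B' by auto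
  from opens obtain q t where q: "q \<in> d" and t: "t > 0" and Fq: "F = q + t *\<^sub>R c *\<^sub>R n"
    and perp: "\<And>x y. x \<in> d \<Longrightarrow> y \<in> d \<Longrightarrow> orthogonal (c *\<^sub>R n) (x - y)"
    unfolding opens_towards_def by blast
  obtain Q where Q: "Q \<noteq> q" "d = affine hull {q, Q}"
    using is_line_eq_affine_hull_2[OF d q] .
  then have "Q \<in> d" by (simp add: hull_inc)
  then have "(Q - q) \<bullet> n = 0"
    using perp[OF _ q] c by (simp add: orthogonal_def inner_commute)
  then have d_eq: "d = sloped_line q 0"
    using affine_hull_eq_sloped_line[of q Q 0] Q by simp
  define k where "k = t * c"
  have k: "k > 0" "F = q + k *\<^sub>R n" using t c Fq by (simp_all add: k_def)
  have infd: "infdist X d = \<bar>(X - F) \<bullet> n + k\<bar>" for X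
    by (simp add: d_eq infdist_horizontal_line k inner_diff_left inner_add_left)
  from F obtain r where r: "0 \<le> r" "r \<le> 1" and Fr: "F = A + (2 * h * r) *\<^sub>R e"
    by (auto simp: in_segment B algebra_simps)
  have "dist A F = k" "dist B F = k"
    using AB infd[of A] infd[of B] k(1)
    by (simp_all add: G_eq parabola_def Fr B inner_diff_left inner_add_left)
  moreover have "B - F = (2 * h * (1 - r)) *\<^sub>R e"
    by (simp add: B Fr algebra_simps)
  ultimately have *: "2 * h * r = k" "2 * h * (1 - r) = k"
    using h r by (simp_all add: dist_norm Fr)
  then have "2 * h * r = 2 * h * (1 - r)" by simp
  then have "r = 1 - r" using h by (simp only: mult_cancel_left) simp
  then have "r = 1 / 2" by simp
  then have F_mid: "F = A + h *\<^sub>R e" and kh: "k = h"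
    using *(1) Fr unfolding \<open>r = 1 / 2\<close> by simp_all
  have "X \<in> parabola F d \<longleftrightarrow> X \<in> upward_parabola F h" for X
  proof -
    have "X \<in> parabola F d \<longleftrightarrow> norm (X - F) = \<bar>(X - F) \<bullet> n + h\<bar>"
      by (simp add: parabola_def infd kh dist_norm)
    also have "\<dots> \<longleftrightarrow> (norm (X - F))\<^sup>2 = ((X - F) \<bullet> n + h)\<^sup>2"
      using power2_eq_iff_nonneg[of "norm (X - F)" "\<bar>(X - F) \<bullet> n + h\<bar>"] by simp
    also have "\<dots> \<longleftrightarrow> X \<in> upward_parabola F h"
      unfolding norm_frame upward_parabola_def
      by (auto simp: power2_eq_square algebra_simps)
    finally show ?thesis .
  qed
  then show ?thesis using G_eq F_mid by blast
qed

section \<open>Tangent lines of a parabola\<close>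

text \<open>The chord from \<open>P\<close> to the point of the parabola whose abscissa exceeds that of \<open>P\<close> by \<open>s\<close>
  has direction \<open>e + (m + s / (2 h)) n\<close>, where \<open>m\<close> is the asserted slope.\<close>

lemma upward_parabola_iff_chord:
  assumes h: "h > 0" and P: "P \<in> upward_parabola F h" and m: "m = ((P - F) \<bullet> e) / h"
  shows "X \<in> upward_parabola F h \<longleftrightarrow>
    (\<exists>s. X = P + s *\<^sub>R (e + (m + s / (2 * h)) *\<^sub>R n))"
proof -
  have hm: "(P - F) \<bullet> e = h * m" using h m by simp
  have P': "(h * m)\<^sup>2 = 2 * h * ((P - F) \<bullet> n) + h\<^sup>2"
    using P hm by (simp add: upward_parabola_def)
  show ?thesis
  proof
    assume X: "X \<in> upward_parabola F h"
    define s where "s = (X - P) \<bullet> e"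
    have xe: "(X - F) \<bullet> e = h * m + s"
      using hm by (simp add: s_def inner_diff_left)
    have "(X - F) \<bullet> n = (P - F) \<bullet> n + (X - P) \<bullet> n" by (simp add: inner_diff_left)
    moreover have "(h * m + s)\<^sup>2 = 2 * h * ((X - F) \<bullet> n) + h\<^sup>2"
      using X by (simp add: upward_parabola_def xe)
    ultimately have "2 * h * ((X - P) \<bullet> n) = (h * m + s)\<^sup>2 - (h * m)\<^sup>2"
      using P' by (simp add: distrib_left)
    then have "(X - P) \<bullet> n = s * (m + s / (2 * h))"
      using h by (simp add: field_simps power2_eq_square)
    then have "X - P = s *\<^sub>R (e + (m + s / (2 * h)) *\<^sub>R n)"
      by (intro frame_eqI) (simp_all add: inner_add_left s_def)
    then show "\<exists>s. X = P + s *\<^sub>R (e + (m + s / (2 * h)) *\<^sub>R n)"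
      by (metis add.commute diff_add_cancel)
  next
    assume "\<exists>s. X = P + s *\<^sub>R (e + (m + s / (2 * h)) *\<^sub>R n)"
    then obtain s where X: "X = P + s *\<^sub>R (e + (m + s / (2 * h)) *\<^sub>R n)" ..
    have "(X - F) \<bullet> e = h * m + s" "(X - F) \<bullet> n = (P - F) \<bullet> n + s * (m + s / (2 * h))"
      using hm by (simp_all add: X inner_add_left inner_diff_left)
    then show "X \<in> upward_parabola F h"
      using P' h by (simp add: upward_parabola_def field_simps power2_eq_square)
  qed
qed

text \<open>Both directions substitute the parametrisation by chords into the definition of tangency.
  For the line of slope \<open>m\<close>, the distance to the line is quadratic in \<open>s\<close> while the length of the
  chord is at least \<open>\<bar>s\<bar>\<close>, so the quotient tends to \<open>0\<close>. Conversely, if \<open>w\<close> is a unit normal of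
  a tangent line, then the quotient is at least the absolute value of the \<open>w\<close>-component of the
  normalised chord direction, which tends to \<open>\<bar>(e + m n) \<bullet> w\<bar> / norm (e + m n)\<close>. This limit is
  therefore \<open>0\<close>, and \<open>e + m n\<close> is parallel to the line.\<close>

lemma tangent_upward_parabola_iff:
  assumes h: "h > 0" and P: "P \<in> upward_parabola F h"
  shows "tangent_line_at (upward_parabola F h) P L \<longleftrightarrow> L = sloped_line P (((P - F) \<bullet> e) / h)"
proof -
  define m where "m = ((P - F) \<bullet> e) / h"
  let ?G = "upward_parabola F h"
  define \<tau> where "\<tau> s = e + (m + s / (2 * h)) *\<^sub>R n" for s
  define \<gamma> where "\<gamma> s = P + s *\<^sub>R \<tau> s" for s
  have G_iff: "X \<in> ?G \<longleftrightarrow> (\<exists>s. X = \<gamma> s)" for X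
    using upward_parabola_iff_chord[OF h P m_def] by (simp add: \<gamma>_def \<tau>_def)
  then have \<gamma>_in_G: "\<gamma> s \<in> ?G" for s by blast
  have \<tau>_e: "\<tau> s \<bullet> e = 1" for s by (simp add: \<tau>_def inner_add_left)
  then have \<tau>_nz: "\<tau> s \<noteq> 0" for s by (metis inner_zero_left zero_neq_one)
  have \<tau>_lim: "(\<tau> \<longlongrightarrow> \<tau> 0) (at 0)"
    unfolding \<tau>_def using h by (auto intro!: tendsto_eq_intros)
  have "(\<gamma> \<longlongrightarrow> P) (at 0)"
    unfolding \<gamma>_def by (rule tendsto_eq_intros tendsto_ident_at \<tau>_lim refl | simp)+
  moreover have "eventually (\<lambda>s. \<gamma> s \<in> ?G \<and> \<gamma> s \<noteq> P) (at 0)"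
    using \<tau>_nz \<gamma>_in_G by (auto simp: eventually_at_filter \<gamma>_def)
  ultimately have \<gamma>_lim: "filterlim \<gamma> (at P within ?G) (at 0)"
    by (simp add: filterlim_at)
  then have "at P within ?G \<noteq> bot"
    by (auto simp: filterlim_def bot_unique filtermap_bot_iff)
  then have islimpt: "P islimpt ?G"
    by (simp add: trivial_limit_within)
  show ?thesis unfolding m_def[symmetric]
  proof
    assume L: "L = sloped_line P m"
    have bound: "infdist Q L / dist Q P \<le> dist Q P / (2 * h)" if Q_in: "Q \<in> ?G" for Q
    proof -
      obtain s where Q: "Q = \<gamma> s" using iffD1[OF G_iff Q_in] by blast
      have s: "\<bar>s\<bar> \<le> dist Q P"
        using Cauchy_Schwarz_ineq2[of "Q - P" e]
        by (simp add: Q \<gamma>_def dist_norm \<tau>_e)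
      have "P + s *\<^sub>R \<tau> 0 \<in> L"
        by (simp add: L sloped_line_def \<tau>_def inner_add_left)
      then have "infdist Q L \<le> dist Q (P + s *\<^sub>R \<tau> 0)" by (rule infdist_le)
      also have "Q - (P + s *\<^sub>R \<tau> 0) = (s\<^sup>2 / (2 * h)) *\<^sub>R n"
        by (simp add: Q \<gamma>_def \<tau>_def algebra_simps power2_eq_square)
      then have "dist Q (P + s *\<^sub>R \<tau> 0) = s\<^sup>2 / (2 * h)"
        using h by (simp add: dist_norm)
      also have "\<dots> \<le> (dist Q P)\<^sup>2 / (2 * h)"
        using s h by (intro divide_right_mono) (auto simp: abs_le_square_iff[symmetric])
      finally have "infdist Q L \<le> dist Q P * (dist Q P / (2 * h))"
        by (simp add: power2_eq_square)
      then show ?thesis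
        using h by (cases "Q = P") (simp_all add: divide_le_eq mult.commute)
    qed
    have "((\<lambda>Q. dist Q P / (2 * h)) \<longlongrightarrow> dist P P / (2 * h)) (at P within ?G)"
      using h by (intro tendsto_intros) auto
    then have "((\<lambda>Q. dist Q P / (2 * h)) \<longlongrightarrow> 0) (at P within ?G)" by simp
    then have "((\<lambda>Q. infdist Q L / dist Q P) \<longlongrightarrow> 0) (at P within ?G)"
      by (rule tendsto_sandwich[rotated 3, where f = "\<lambda>_. 0"])
         (auto simp: eventually_at_filter infdist_nonneg intro!: always_eventually bound)
    then show "tangent_line_at ?G P L"
      using P islimpt is_line_sloped_line by (simp add: tangent_line_at_def L sloped_line_def)
  next
    assume T: "tangent_line_at ?G P L"
    then obtain Q where Q: "Q \<noteq> P" and L: "L = affine hull {P, Q}"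
      using is_line_eq_affine_hull_2 unfolding tangent_line_at_def by metis
    define v where "v = Q - P"
    \<comment> \<open>\<open>w\<close> is the unit vector \<open>v / norm v\<close> turned by a right angle.\<close>
    define w where "w = (1 / norm v) *\<^sub>R ((v \<bullet> e) *\<^sub>R n - (v \<bullet> n) *\<^sub>R e)"
    have v0: "v \<noteq> 0" using Q by (simp add: v_def)
    have "(norm ((v \<bullet> e) *\<^sub>R n - (v \<bullet> n) *\<^sub>R e))\<^sup>2 = (norm v)\<^sup>2"
      unfolding norm_frame[of v] norm_frame[of "(v \<bullet> e) *\<^sub>R n - (v \<bullet> n) *\<^sub>R e"]
      by (simp add: inner_diff_left)
    then have "norm ((v \<bullet> e) *\<^sub>R n - (v \<bullet> n) *\<^sub>R e) = norm v"
      by simp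
    then have norm_w: "norm w = 1" using v0 by (simp add: w_def)
    have "v \<bullet> w = 0" by (simp add: w_def inner_diff_right)
    moreover have "\<exists>r. Y - P = r *\<^sub>R v" if Y: "Y \<in> L" for Y
    proof -
      obtain r t where Y_comb: "Y = r *\<^sub>R P + t *\<^sub>R Q" and "r + t = 1"
        using Y by (auto simp: L affine_hull_2)
      then have "r = 1 - t" by simp
      with Y_comb have "Y - P = t *\<^sub>R v" by (simp add: v_def algebra_simps)
      then show ?thesis ..
    qed
    ultimately have L_orth: "(Y - P) \<bullet> w = 0" if "Y \<in> L" for Y
      using that by fastforce
    have lower: "\<bar>(X - P) \<bullet> w\<bar> \<le> infdist X L" for X
      by (rule abs_inner_le_infdist[OF norm_w _ L_orth]) (simp_all add: L hull_inc)
    have "((\<lambda>s. infdist (\<gamma> s) L / dist (\<gamma> s) P) \<longlongrightarrow> 0) (at 0)"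
      using T \<gamma>_lim unfolding tangent_line_at_def by (auto intro: filterlim_compose)
    moreover have "((\<lambda>s. \<bar>\<tau> s \<bullet> w\<bar> / norm (\<tau> s)) \<longlongrightarrow> \<bar>\<tau> 0 \<bullet> w\<bar> / norm (\<tau> 0)) (at 0)"
      using \<tau>_nz by (intro tendsto_intros \<tau>_lim) auto
    moreover have "eventually (\<lambda>s. \<bar>\<tau> s \<bullet> w\<bar> / norm (\<tau> s) \<le> infdist (\<gamma> s) L / dist (\<gamma> s) P) (at 0)"
      unfolding eventually_at_filter
    proof (intro always_eventually allI impI)
      fix s :: real
      assume s: "s \<noteq> 0"
      have "\<bar>s\<bar> * \<bar>\<tau> s \<bullet> w\<bar> \<le> infdist (\<gamma> s) L"
        using lower[of "\<gamma> s"] by (simp add: \<gamma>_def abs_mult)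
      then have "\<bar>s\<bar> * \<bar>\<tau> s \<bullet> w\<bar> / (\<bar>s\<bar> * norm (\<tau> s)) \<le> infdist (\<gamma> s) L / (\<bar>s\<bar> * norm (\<tau> s))"
        by (rule divide_right_mono) simp
      then show "\<bar>\<tau> s \<bullet> w\<bar> / norm (\<tau> s) \<le> infdist (\<gamma> s) L / dist (\<gamma> s) P"
        using s by (simp add: \<gamma>_def dist_norm)
    qed
    ultimately have "\<bar>\<tau> 0 \<bullet> w\<bar> / norm (\<tau> 0) \<le> 0"
      by (rule tendsto_le[OF at_neq_bot])
    then have "\<tau> 0 \<bullet> w = 0"
      using \<tau>_nz[of 0] by (simp add: divide_le_0_iff)
    moreover have "\<tau> 0 \<bullet> w = (m * (v \<bullet> e) - v \<bullet> n) / norm v"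
      by (simp add: \<tau>_def w_def inner_add_left inner_diff_right)
    ultimately have "v \<bullet> n = m * (v \<bullet> e)"
      using v0 by simp
    then show "L = sloped_line P m"
      using affine_hull_eq_sloped_line[of P Q m] Q by (simp add: L v_def)
  qed
qed

lemma tangent_upward_parabolaD:
  assumes "h > 0" and "tangent_line_at (upward_parabola F h) P L"
  shows "L = sloped_line P (((P - F) \<bullet> e) / h)"
proof -
  have "P \<in> upward_parabola F h"
    using assms(2) by (simp add: tangent_line_at_def)
  then show ?thesis
    using assms tangent_upward_parabola_iff by blast
qed

lemma tangent_point_unique:
  assumes h: "h > 0" and P: "tangent_line_at (upward_parabola F h) P L"
    and Q: "tangent_line_at (upward_parabola F h) Q L"
  shows "Q = P"
proof -
  let ?p = "(P - F) \<bullet> e" and ?q = "(Q - F) \<bullet> e"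
  have L: "L = sloped_line P (?p / h)" "L = sloped_line Q (?q / h)"
    using tangent_upward_parabolaD[OF h] P Q by auto
  then have "?p / h = ?q / h"
    using sloped_line_eqD by metis
  then have pq: "?p = ?q" using h by simp
  then have "(Q - P) \<bullet> e = 0" by (simp add: inner_diff_left)
  moreover have "Q \<in> L" using Q by (simp add: tangent_line_at_def)
  ultimately have "(Q - P) \<bullet> n = 0" by (simp add: L(1) sloped_line_def)
  with \<open>(Q - P) \<bullet> e = 0\<close> have "Q - P = 0" by (intro frame_eqI) simp_all
  then show ?thesis by simp
qed

section \<open>The bisector of a right angle\<close>

lemma vertical_in_internal_bisector:
  assumes "a > 0" "b > 0" "k > 0"
  shows "V - k *\<^sub>R n \<in> internal_bisector (V - a *\<^sub>R (e + n)) V (V + b *\<^sub>R (e - n))"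
proof -
  have n2: "norm (e + n) = sqrt 2" "norm (e - n) = sqrt 2"
    by (simp_all add: norm_eq_sqrt_inner inner_add_left inner_add_right
        inner_diff_left inner_diff_right)
  have "1 / sqrt 2 = cos (pi / 4)" by (simp add: cos_45 field_simps)
  then have arc: "arccos (1 / sqrt 2) = pi / 4"
    by (simp add: arccos_cos)
  have "angle_at (V - a *\<^sub>R (e + n)) V (V + b *\<^sub>R (e - n)) = pi / 2"
    by (simp add: angle_at_def inner_add_left inner_diff_right)
  moreover have "angle_at (V - a *\<^sub>R (e + n)) V (V - k *\<^sub>R n) = pi / 4"
    using assms arc by (simp add: angle_at_def n2 inner_add_left)
  moreover have "angle_at (V - k *\<^sub>R n) V (V + b *\<^sub>R (e - n)) = pi / 4"
    using assms arc by (simp add: angle_at_def n2 inner_diff_right mult.commute)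
  ultimately show ?thesis
    using assms norm_n by (auto simp: internal_bisector_def)
qed

section \<open>The diagonal of the tangent rectangle\<close>

lemma parbelos_diagonal_tangent:
  assumes a: "a > 0" and b: "b > 0" and c: "c > 0"
    and C1: "C1 = C2 - (2 * a) *\<^sub>R e" and C3: "C3 = C2 + (2 * b) *\<^sub>R e"
    and G1: "parabola_on_latus_rectum (c *\<^sub>R n) C1 C2 G1"
    and G2: "parabola_on_latus_rectum (c *\<^sub>R n) C1 C3 G2"
    and G3: "parabola_on_latus_rectum (c *\<^sub>R n) C2 C3 G3"
    and t1: "tangent_line_at G2 C1 t1" and t3: "tangent_line_at G2 C3 t3"
    and m1: "tangent_line_at G1 C2 m1" and m3: "tangent_line_at G3 C2 m3"
    and T1: "T1 \<in> t1 \<inter> m1" and T3: "T3 \<in> t3 \<inter> m3"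
  shows "\<exists>P \<in> closed_segment T1 T3.
           tangent_line_at G2 P (affine hull {T1, T3}) \<and>
           (\<forall>Q. tangent_line_at G2 Q (affine hull {T1, T3}) \<longrightarrow> Q = P) \<and>
           P \<in> internal_bisector T1 C2 T3"
proof -
  have ab: "a + b > 0" using a b by simp
  have C12: "C2 = C1 + (2 * a) *\<^sub>R e" and F1: "C1 + a *\<^sub>R e = C2 - a *\<^sub>R e"
    by (rule frame_eqI; simp add: C1 inner_diff_left inner_add_left)+
  have G1: "G1 = upward_parabola (C2 - a *\<^sub>R e) a"
    using parabola_on_latus_rectum_eq_upward_parabola[OF c a C12 G1] unfolding F1 .
  have G3: "G3 = upward_parabola (C2 + b *\<^sub>R e) b"
    using parabola_on_latus_rectum_eq_upward_parabola[OF c b C3 G3] .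
  define F where "F = C2 + (b - a) *\<^sub>R e"
  have "C3 = C1 + (2 * (a + b)) *\<^sub>R e" "C1 + (a + b) *\<^sub>R e = F"
    by (rule frame_eqI; simp add: C1 C3 F_def inner_diff_left inner_add_left)+
  then have G2: "G2 = upward_parabola F (a + b)"
    using parabola_on_latus_rectum_eq_upward_parabola[OF c ab _ G2] by simp
  have t1: "t1 = sloped_line C1 (- 1)"
  proof -
    have "(C1 - F) \<bullet> e = - (a + b)" by (simp add: C1 F_def inner_diff_left inner_add_left)
    then have "(C1 - F) \<bullet> e / (a + b) = - 1"
      using ab by (simp add: divide_eq_eq)
    then show ?thesis using tangent_upward_parabolaD[OF ab t1[unfolded G2]] by simp
  qed
  have t3: "t3 = sloped_line C3 1"
  proof -
    have "(C3 - F) \<bullet> e = a + b" by (simp add: C3 F_def inner_diff_left inner_add_left)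
    then have "(C3 - F) \<bullet> e / (a + b) = 1" using ab by simp
    then show ?thesis using tangent_upward_parabolaD[OF ab t3[unfolded G2]] by simp
  qed
  have m1: "m1 = sloped_line C2 1"
    using tangent_upward_parabolaD[OF a m1[unfolded G1]] a by simp
  have m3: "m3 = sloped_line C2 (- 1)"
    using tangent_upward_parabolaD[OF b m3[unfolded G3]] b by simp
  have "T1 - C2 = - a *\<^sub>R (e + n)"
    by (rule frame_eqI)
       (use T1 in \<open>simp_all add: t1 m1 sloped_line_def C1 inner_diff_left inner_add_left\<close>)
  then have T1: "T1 = C2 - a *\<^sub>R (e + n)" by (simp add: algebra_simps)
  have "T3 - C2 = b *\<^sub>R (e - n)"
    by (rule frame_eqI)
       (use T3 in \<open>simp_all add: t3 m3 sloped_line_def C3 inner_diff_left inner_add_left\<close>)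
  then have T3: "T3 = C2 + b *\<^sub>R (e - n)" by (simp add: algebra_simps)
  define k where "k = 2 * a * b / (a + b)"
  have k: "k > 0" using a b by (simp add: k_def)
  define P where "P = C2 - k *\<^sub>R n"
  have diag: "T3 - T1 = (a + b) *\<^sub>R e + (a - b) *\<^sub>R n"
    by (simp add: T1 T3 algebra_simps)
  have "a / (a + b) * (a - b) = a - k" "a / (a + b) * (a + b) = a"
    using ab by (simp_all add: k_def field_simps)
  then have "(a / (a + b)) *\<^sub>R (T3 - T1) = a *\<^sub>R e + (a - k) *\<^sub>R n"
    unfolding diag scaleR_add_right scaleR_scaleR by (simp only:)
  then have P_T1: "P - T1 = (a / (a + b)) *\<^sub>R (T3 - T1)"
    by (simp add: P_def T1 algebra_simps)
  then have "P = (1 - a / (a + b)) *\<^sub>R T1 + (a / (a + b)) *\<^sub>R T3"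
    by (simp add: algebra_simps)
  then have seg: "P \<in> closed_segment T1 T3"
    using a b by (auto simp: in_segment intro!: exI[of _ "a / (a + b)"])
  have "(P - F) \<bullet> e = a - b" "(P - F) \<bullet> n = - k"
    by (simp_all add: P_def F_def inner_diff_left inner_add_left)
  moreover have "(a - b)\<^sup>2 = 2 * (a + b) * (- k) + (a + b)\<^sup>2"
    using ab by (simp add: k_def field_simps power2_eq_square)
  ultimately have P_in: "P \<in> upward_parabola F (a + b)"
    and slope: "(P - F) \<bullet> e / (a + b) = (a - b) / (a + b)"
    by (simp_all add: upward_parabola_def)
  have T3_T1: "(T3 - T1) \<bullet> e = a + b" "(T3 - T1) \<bullet> n = a - b"
    unfolding diag by (simp_all add: inner_add_left)
  then have "T1 \<noteq> T3" using ab by auto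
  then have hull: "affine hull {T1, T3} = sloped_line T1 ((a - b) / (a + b))"
    by (rule affine_hull_eq_sloped_line) (use ab T3_T1 in simp)
  have "P \<in> sloped_line T1 ((a - b) / (a + b))"
    using ab by (simp add: sloped_line_def P_T1 T3_T1)
  then have "sloped_line T1 ((a - b) / (a + b)) = sloped_line P ((a - b) / (a + b))"
    by (rule sloped_line_change_point)
  then have tangent: "tangent_line_at G2 P (affine hull {T1, T3})"
    using tangent_upward_parabola_iff[OF ab P_in] by (simp add: G2 hull slope)
  moreover have "Q = P" if "tangent_line_at G2 Q (affine hull {T1, T3})" for Q
    using tangent_point_unique[OF ab] tangent that unfolding G2 by blast
  moreover have "P \<in> internal_bisector T1 C2 T3"
    unfolding P_def T1 T3 using a b k by (rule vertical_in_internal_bisector)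
  ultimately show ?thesis using seg by blast
qed

end

theorem theorem4:
  fixes C1 C2 C3 T1 T2 T3 u :: point
    and G1 G2 G3 t1 t3 m1 m3 :: "point set"
  assumes "C1 \<noteq> C2" and "C2 \<noteq> C3" and "C1 \<noteq> C3" and "between (C1, C3) C2"
    and "u \<noteq> 0" and "orthogonal u (C3 - C1)"
    and "parabola_on_latus_rectum u C1 C2 G1"
    and "parabola_on_latus_rectum u C1 C3 G2"
    and "parabola_on_latus_rectum u C2 C3 G3"
    and "tangent_line_at G2 C1 t1" and "tangent_line_at G2 C3 t3"
    and "tangent_line_at G1 C2 m1" and "tangent_line_at G3 C2 m3"
    and "t1 \<inter> m1 = {T1}" and "t1 \<inter> t3 = {T2}" and "t3 \<inter> m3 = {T3}"
  shows "\<exists>P \<in> closed_segment T1 T3.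
           tangent_line_at G2 P (affine hull {T1, T3}) \<and>
           (\<forall>Q. tangent_line_at G2 Q (affine hull {T1, T3}) \<longrightarrow> Q = P) \<and>
           P \<in> internal_bisector T1 C2 T3"
proof -
  define D where "D = norm (C3 - C1)"
  define e where "e = (1 / D) *\<^sub>R (C3 - C1)"
  define n where "n = (1 / norm u) *\<^sub>R u"
  have D: "D > 0" using \<open>C1 \<noteq> C3\<close> by (simp add: D_def)
  interpret orthonormal_frame e n
  proof
    show "norm e = 1" using D by (simp add: e_def D_def)
    show "norm n = 1" using \<open>u \<noteq> 0\<close> by (simp add: n_def)
    show "e \<bullet> n = 0"
      using \<open>orthogonal u (C3 - C1)\<close> by (simp add: e_def n_def orthogonal_def inner_commute)
  qed
  have u: "norm u *\<^sub>R n = u" using \<open>u \<noteq> 0\<close> by (simp add: n_def)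
  have C31: "C3 = C1 + D *\<^sub>R e" using D by (simp add: e_def)
  from \<open>between (C1, C3) C2\<close> obtain r where r: "0 \<le> r" "r \<le> 1"
    and C2r: "C2 = C1 + (r * D) *\<^sub>R e"
    unfolding between_mem_segment in_segment C31 by (auto simp: algebra_simps)
  have "r \<noteq> 0" "r \<noteq> 1"
    using \<open>C1 \<noteq> C2\<close> \<open>C2 \<noteq> C3\<close> C2r C31 by auto
  then have "r * D / 2 > 0" "(1 - r) * D / 2 > 0" using r D by auto
  moreover have "C1 = C2 - (2 * (r * D / 2)) *\<^sub>R e" "C3 = C2 + (2 * ((1 - r) * D / 2)) *\<^sub>R e"
    by (rule frame_eqI; simp add: C2r C31 inner_diff_left inner_add_left field_simps)+
  moreover have "norm u > 0" using \<open>u \<noteq> 0\<close> by simp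
  moreover have "T1 \<in> t1 \<inter> m1" "T3 \<in> t3 \<inter> m3"
    using \<open>t1 \<inter> m1 = {T1}\<close> \<open>t3 \<inter> m3 = {T3}\<close> by auto
  ultimately show ?thesis
    using assms(7-13) parbelos_diagonal_tangent[where c = "norm u", unfolded u] by blast
qed

end
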